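(* Let $r_1,r_2\in\mathbb{Z}$ and let $(U_n)_{n\ge0}$ be a sequence of integers with $U_n=r_1U_{n-1}+r_2U_{n-2}$ for all $n\ge2$, where the roots of $x^2-r_1x-r_2$ are distinct. Then the sequence $(U_{n^2})_{n\ge1}$ almost satisfies the Dold condition.
   Context: A sequence of integers $(A_n)_{n\ge1}$ satisfies the Dold condition if $n\mid\sum_{d\mid n}\mu(d)A_{n/d}$ for every $n\in\mathbb{N}_+$ ($\mu$ the Möbius function). It almost satisfies the Dold condition if there is $c\in\mathbb{N}_+$ such that $(cA_n)_{n\ge1}$ satisfies the Dold condition. *)

theory Defs
  imports
    Complex_Main
    "HOL-Computational_Algebra.Polynomial"
    "HOL-Computational_Algebra.Squarefree"
begin

definition moebius_mu :: "nat \<Rightarrow> int" where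
  "moebius_mu n = (if squarefree n then (-1) ^ card (prime_factors n) else 0)"

text \<open>
  A sequence indexed by the positive integers is a function on \<^typ>\<open>nat\<close>
  whose value at 0 is irrelevant: for \<open>n > 0\<close> only values at positive
  indices occur below.
\<close>

definition dold :: "(nat \<Rightarrow> int) \<Rightarrow> bool" where
  "dold A \<longleftrightarrow> (\<forall>n>0. int n dvd (\<Sum>d | d dvd n. moebius_mu d * A (n div d)))"

definition almost_dold :: "(nat \<Rightarrow> int) \<Rightarrow> bool" where
  "almost_dold A \<longleftrightarrow> (\<exists>c::nat. c > 0 \<and> dold (\<lambda>n. int c * A n))"

end

theory Submission
  imports Defs
begin

text \<open>
  Take \<open>c = \<bar>D\<bar>\<close> with \<open>D = r\<^sub>1\<^sup>2 + 4 r\<^sub>2 \<noteq> 0\<close>. By a standard criterion it suffices that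
  \<open>p\<^sup>k\<close> divides \<open>A (p\<^sup>k m) - A (p\<^sup>k\<^sup>-\<^sup>1 m)\<close> for all primes \<open>p\<close> not dividing \<open>m\<close>. Since \<open>U\<close> is
  the image of the powers of \<open>x\<close> under a linear functional on \<open>\<int>[x]\<close> that vanishes on the ideal
  generated by \<open>f = x\<^sup>2 - r\<^sub>1 x - r\<^sub>2\<close>, everything reduces to congruences between powers of \<open>x\<close>
  modulo \<open>(f, p\<^sup>k)\<close>. Modulo \<open>(f, p)\<close> the squared Frobenius fixes \<open>x\<close> if \<open>p\<close> does not divide \<open>D\<close>
  and fixes \<open>x\<^sup>p\<close> always, so \<open>D (x\<^bsup>p\<^sup>2\<^esup> - x)\<close> and \<open>x\<^bsup>p\<^sup>3\<^esup> - x\<^sup>p\<close> lie in \<open>(f, p)\<close>. The first settles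
  \<open>k = 1\<close>; raising the second to the power \<open>p\<^bsup>2k-3\<^esup>\<close> gives a congruence modulo \<open>p\<^bsup>2k-2\<^esup>\<close>,
  which suffices for \<open>k \<ge> 2\<close>.
\<close>

section \<open>Moebius sums and a prime-by-prime criterion\<close>

lemma moebius_mu_prime_mult:
  assumes p: "prime p" and "\<not> p dvd d"
  shows "moebius_mu (p * d) = - moebius_mu d"
proof -
  have cop: "coprime p d"
    using assms by (simp add: prime_imp_coprime)
  have "d \<noteq> 0" using assms by (metis dvd_0_right)
  then have "prime_factors (p * d) = insert p (prime_factors d)"
    using p by (simp add: prime_factors_product prime_prime_factors not_prime_0)
  moreover have "p \<notin> prime_factors d"
    using assms by auto
  ultimately have "card (prime_factors (p * d)) = Suc (card (prime_factors d))"
    by simp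
  moreover have "squarefree (p * d) \<longleftrightarrow> squarefree d"
    using cop p by (metis squarefree_mult_coprime squarefree_prime squarefree_multD(2))
  ultimately show ?thesis
    by (simp add: moebius_mu_def)
qed

text \<open>Only squarefree divisors contribute, and each is \<open>d\<close> or
  \<open>p * d\<close> for a unique \<open>d\<close> dividing \<open>m\<close>. These two terms
  carry opposite values of \<open>moebius_mu\<close>, so they pair up to a difference.\<close>

lemma sum_moebius_mu_prime_power_mult:
  fixes A :: "nat \<Rightarrow> int"
  assumes p: "prime p" and k: "k > 0" and m: "\<not> p dvd m"
  shows "(\<Sum>d | d dvd p ^ k * m. moebius_mu d * A (p ^ k * m div d)) =
    (\<Sum>d | d dvd m. moebius_mu d * (A (p ^ k * (m div d)) - A (p ^ (k - 1) * (m div d))))"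
proof -
  have m0: "m > 0" using m by (metis dvd_0_right neq0_conv)
  have p0: "p > 0" using p by (simp add: prime_gt_0_nat)
  have fin: "finite {d. d dvd m}" using m0 by simp
  let ?g = "\<lambda>d. moebius_mu d * A (p ^ k * m div d)"
  let ?S = "{d. d dvd m} \<union> (*) p ` {d. d dvd m}"
  have ps: "p ^ k = p * p ^ (k - 1)" using k by (cases k) auto
  have "sum ?g {d. d dvd p ^ k * m} = sum ?g ?S"
  proof (rule sum.mono_neutral_right)
    show "finite {d. d dvd p ^ k * m}" using m0 p0 by simp
    show "?S \<subseteq> {d. d dvd p ^ k * m}"
      using ps by (auto intro: mult_dvd_mono)
    show "\<forall>d\<in>{d. d dvd p ^ k * m} - ?S. ?g d = 0"
    proof
      fix d assume d: "d \<in> {d. d dvd p ^ k * m} - ?S"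
      have "\<not> squarefree d"
      proof
        assume sf: "squarefree d"
        show False
        proof (cases "p dvd d")
          case False
          then have "coprime d (p ^ k)"
            using prime_imp_coprime[OF p] by (simp add: coprime_commute)
          then have "d dvd m" using d by (simp add: coprime_dvd_mult_right_iff)
          then show False using d by simp
        next
          case True
          then obtain e where e: "d = p * e" by (auto elim: dvdE)
          have "\<not> p dvd e"
          proof
            assume "p dvd e"
            then have "p\<^sup>2 dvd d" using e by (auto simp: power2_eq_square)
            then have "p dvd 1" using sf unfolding squarefree_def by blast
            then show False using p by simp
          qed
          then have "coprime e (p ^ (k - 1))"
            using prime_imp_coprime[OF p] by (simp add: coprime_commute)
          moreover have "e dvd p ^ (k - 1) * m"
            using d p0 unfolding e ps by simp
          ultimately have "e dvd m" by (simp add: coprime_dvd_mult_right_iff)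
          then show False using d e by auto
        qed
      qed
      then show "?g d = 0" by (simp add: moebius_mu_def)
    qed
  qed
  also have "\<dots> = sum ?g {d. d dvd m} + sum ?g ((*) p ` {d. d dvd m})"
    using m fin by (intro sum.union_disjoint) (auto dest: dvd_mult_left)
  also have "sum ?g ((*) p ` {d. d dvd m}) = (\<Sum>d | d dvd m. ?g (p * d))"
    using p0 by (subst sum.reindex) (auto simp: inj_on_def)
  also have "sum ?g {d. d dvd m} + \<dots> = (\<Sum>d | d dvd m. ?g d + ?g (p * d))"
    by (simp add: sum.distrib)
  also have "\<dots> = (\<Sum>d | d dvd m. moebius_mu d * (A (p ^ k * (m div d)) - A (p ^ (k - 1) * (m div d))))"
  proof (rule sum.cong[OF refl])
    fix d assume "d \<in> {d. d dvd m}"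
    then have d: "d dvd m" by simp
    then have "\<not> p dvd d" using m by (meson dvd_trans)
    then have "moebius_mu (p * d) = - moebius_mu d"
      by (rule moebius_mu_prime_mult[OF p])
    moreover have "p ^ k * m div d = p ^ k * (m div d)"
      using d by (simp add: div_mult_swap)
    moreover have "p ^ k * m div (p * d) = p ^ (k - 1) * (m div d)"
      using d p0 unfolding ps by (simp add: mult.assoc div_mult_swap)
    ultimately show "?g d + ?g (p * d) =
        moebius_mu d * (A (p ^ k * (m div d)) - A (p ^ (k - 1) * (m div d)))"
      by (simp add: algebra_simps)
  qed
  finally show ?thesis .
qed

text \<open>Splitting off the exact power \<open>p ^ k\<close> in \<open>n\<close> turns the Moebius
  sum into a combination of differences as in the hypothesis, at cofactors \<open>m div d\<close>
  still prime to \<open>p\<close>. Comparing multiplicities at all primes then gives divisibility by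
  \<open>n\<close>.\<close>

lemma doldI:
  fixes A :: "nat \<Rightarrow> int"
  assumes A: "\<And>p k m. prime p \<Longrightarrow> k > 0 \<Longrightarrow> \<not> p dvd m \<Longrightarrow>
    int p ^ k dvd A (p ^ k * m) - A (p ^ (k - 1) * m)"
  shows "dold A"
  unfolding dold_def
proof (intro allI impI)
  fix n :: nat assume n: "n > 0"
  let ?s = "\<Sum>d | d dvd n. moebius_mu d * A (n div d)"
  have pp: "p ^ multiplicity p n dvd nat \<bar>?s\<bar>" if p: "prime p" for p
  proof (cases "p dvd n")
    case False
    then show ?thesis by (simp add: not_dvd_imp_multiplicity_0)
  next
    case True
    define k where "k = multiplicity p n"
    have k: "k > 0" using True p n by (simp add: k_def prime_multiplicity_gt_zero_iff)
    obtain m where m: "n = p ^ k * m" "\<not> p dvd m"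
      using multiplicity_decompose'[of n p] n p unfolding k_def
      by (metis not_prime_unit neq0_conv)
    have "?s = (\<Sum>d | d dvd m. moebius_mu d * (A (p ^ k * (m div d)) - A (p ^ (k - 1) * (m div d))))"
      using sum_moebius_mu_prime_power_mult[OF p k m(2), of A] unfolding m(1)[symmetric] .
    also have "int p ^ k dvd \<dots>"
    proof (intro dvd_sum dvd_mult A p k)
      fix d assume "d \<in> {d. d dvd m}"
      then have "m div d dvd m" by auto
      then show "\<not> p dvd m div d" using m(2) by (meson dvd_trans)
    qed
    finally have "int (p ^ k) dvd int (nat \<bar>?s\<bar>)" by simp
    then show ?thesis unfolding k_def int_dvd_int_iff .
  qed
  have "n dvd nat \<bar>?s\<bar>"
  \<comment> \<open>As \<open>multiplicity p 0\<close> is 0 by convention, multiplicities can be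
    compared only for a nonzero sum.\<close>
  proof (cases "?s = 0")
    case False
    show ?thesis
    proof (rule multiplicity_le_imp_dvd)
      show "n \<noteq> 0" using n by simp
      fix p :: nat assume p: "prime p"
      show "multiplicity p n \<le> multiplicity p (nat \<bar>?s\<bar>)"
        using pp[OF p] p False by (intro multiplicity_geI) auto
    qed
  qed simp
  then have "int n dvd int (nat \<bar>?s\<bar>)" unfolding int_dvd_int_iff .
  then show "int n dvd ?s" by simp
qed

section \<open>Congruences modulo an ideal with two generators\<close>

definition ideal2 :: "'a::comm_ring_1 \<Rightarrow> 'a \<Rightarrow> 'a set" where
  "ideal2 f g = {f * a + g * b | a b. True}"

lemma ideal2_0 [simp]: "0 \<in> ideal2 f g"
  unfolding ideal2_def by (rule CollectI, rule exI[of _ 0], rule exI[of _ 0]) simp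

lemma ideal2_left: "f dvd x \<Longrightarrow> x \<in> ideal2 f g"
proof -
  assume "f dvd x"
  then obtain k where "x = f * k + g * 0" by (auto elim: dvdE)
  then show ?thesis unfolding ideal2_def by blast
qed

lemma ideal2_right: "g dvd x \<Longrightarrow> x \<in> ideal2 f g"
proof -
  assume "g dvd x"
  then obtain k where "x = f * 0 + g * k" by (auto elim: dvdE)
  then show ?thesis unfolding ideal2_def by blast
qed

lemma ideal2_add: "x \<in> ideal2 f g \<Longrightarrow> y \<in> ideal2 f g \<Longrightarrow> x + y \<in> ideal2 f g"
proof -
  assume "x \<in> ideal2 f g" "y \<in> ideal2 f g"
  then obtain a b c d where "x = f * a + g * b" "y = f * c + g * d"
    by (auto simp: ideal2_def)
  then have "x + y = f * (a + c) + g * (b + d)" by (simp add: algebra_simps)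
  then show ?thesis by (auto simp: ideal2_def)
qed

lemma ideal2_mult_left: "x \<in> ideal2 f g \<Longrightarrow> c * x \<in> ideal2 f g"
proof -
  assume "x \<in> ideal2 f g"
  then obtain a b where "x = f * a + g * b"
    by (auto simp: ideal2_def)
  then have "c * x = f * (c * a) + g * (c * b)" by (simp add: algebra_simps)
  then show ?thesis by (auto simp: ideal2_def)
qed

lemma ideal2_dvd: "x \<in> ideal2 f g \<Longrightarrow> x dvd y \<Longrightarrow> y \<in> ideal2 f g"
  by (auto elim!: dvdE simp: mult.commute[of x] intro: ideal2_mult_left)

lemma ideal2_diff: "x \<in> ideal2 f g \<Longrightarrow> y \<in> ideal2 f g \<Longrightarrow> x - y \<in> ideal2 f g"
  using ideal2_add[of x f g "- y"] ideal2_dvd[of y f g "- y"] by simp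

lemma ideal2_sum: "(\<And>i. i \<in> S \<Longrightarrow> h i \<in> ideal2 f g) \<Longrightarrow> sum h S \<in> ideal2 f g"
  by (induction S rule: infinite_finite_induct) (auto intro: ideal2_add)

lemma ideal2_mono: "h dvd g \<Longrightarrow> ideal2 f g \<subseteq> ideal2 f h"
  by (fastforce simp: ideal2_def mult.assoc elim!: dvdE)

text \<open>In the expanded product the only term without a factor \<open>f\<close> is a multiple of
  \<open>g * h\<close>; this is what gains a power of \<open>p\<close> in the lifting below.\<close>

lemma ideal2_mult:
  assumes "x \<in> ideal2 f g" "y \<in> ideal2 f h"
  shows "x * y \<in> ideal2 f (g * h)"
proof -
  obtain a b c d where "x = f * a + g * b" "y = f * c + h * d"
    using assms by (auto simp: ideal2_def)
  then have "x * y = f * (a * y + c * (g * b)) + (g * h) * (b * d)"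
    by (simp add: algebra_simps)
  then show ?thesis by (auto simp: ideal2_def)
qed

lemma power_diff_dvd: "(x::'a::comm_ring_1) - y dvd x ^ n - y ^ n"
  by (simp add: power_diff_sumr2)

text \<open>The cofactor of \<open>x - y\<close> in \<open>x ^ p - y ^ p\<close> is a sum of
  \<open>p\<close> terms, each congruent to \<open>y ^ (p - 1)\<close> modulo \<open>(f, p)\<close>.
  So it lies in \<open>(f, p)\<close> and contributes the extra factor \<open>p\<close>.\<close>

lemma ideal2_power_prime_lift:
  fixes x y :: "'a::comm_ring_1"
  assumes xy: "x - y \<in> ideal2 f (of_nat p ^ j)" and j: "j > 0"
  shows "x ^ p - y ^ p \<in> ideal2 f (of_nat p ^ Suc j)"
proof -
  let ?I = "ideal2 f (of_nat p)"
  have xyp: "x - y \<in> ?I"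
    using xy ideal2_mono[of "of_nat p" "of_nat p ^ j" f] j by auto
  have "y ^ (p - Suc i) * x ^ i - y ^ (p - 1) \<in> ?I" if "i < p" for i
  proof -
    have "y ^ (p - 1) = y ^ (p - Suc i) * y ^ i"
      using that by (simp flip: power_add)
    then have "y ^ (p - Suc i) * x ^ i - y ^ (p - 1) = y ^ (p - Suc i) * (x ^ i - y ^ i)"
      by (simp add: algebra_simps)
    then show ?thesis
      using ideal2_dvd[OF xyp power_diff_dvd, of i] by (simp add: ideal2_mult_left)
  qed
  then have "(\<Sum>i<p. y ^ (p - Suc i) * x ^ i - y ^ (p - 1)) \<in> ?I"
    by (intro ideal2_sum) auto
  then have "(\<Sum>i<p. y ^ (p - Suc i) * x ^ i) - of_nat p * y ^ (p - 1) \<in> ?I"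
    by (simp add: sum_subtractf)
  moreover have "of_nat p * y ^ (p - 1) \<in> ?I" by (simp add: ideal2_right)
  ultimately have "(\<Sum>i<p. y ^ (p - Suc i) * x ^ i) \<in> ?I"
    using ideal2_add by fastforce
  from ideal2_mult[OF xy this] show ?thesis
    by (simp add: power_diff_sumr2 mult.commute)
qed

lemma ideal2_power_prime_power_lift:
  fixes x y :: "'a::comm_ring_1"
  assumes "x - y \<in> ideal2 f (of_nat p)"
  shows "x ^ p ^ j - y ^ p ^ j \<in> ideal2 f (of_nat p ^ Suc j)"
proof (induction j)
  case (Suc j)
  from ideal2_power_prime_lift[OF this] show ?case
    by (simp add: power_mult[symmetric] mult.commute)
qed (use assms in simp)

section \<open>The Frobenius map modulo a prime\<close>

lemma prime_dvd_binomial_power: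
  fixes x y :: "'a::comm_ring_1"
  assumes p: "prime p"
  shows "of_nat p dvd (x + y) ^ p - (x ^ p + y ^ p)"
proof -
  have p0: "p > 0" using p by (simp add: prime_gt_0_nat)
  have "{..p} = insert 0 (insert p {0<..<p})" using p0 by auto
  then have "(x + y) ^ p - (x ^ p + y ^ p) =
      (\<Sum>k\<in>{0<..<p}. of_nat (p choose k) * x ^ k * y ^ (p - k))"
    using p0 by (simp add: binomial_ring)
  also have "of_nat p dvd \<dots>"
  proof (intro dvd_sum dvd_mult2)
    fix k assume "k \<in> {0<..<p}"
    then have "p dvd p choose k" using p by (intro dvd_choose_prime) auto
    then show "(of_nat p :: 'a) dvd of_nat (p choose k)"
      by (auto elim!: dvdE)
  qed
  finally show ?thesis .
qed

text \<open>Fermat's little theorem: additivity of the \<open>p\<close>-th power modulo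
  \<open>p\<close> makes the claims for \<open>b\<close> and \<open>b + 1\<close> equivalent, so
  induction from 0 runs in both directions.\<close>

lemma prime_dvd_power_diff_self:
  fixes a :: int
  assumes p: "prime p"
  shows "int p dvd a ^ p - a"
proof -
  have step: "int p dvd (b + 1) ^ p - (b + 1) \<longleftrightarrow> int p dvd b ^ p - b" for b :: int
  proof -
    have "int p dvd (b + 1) ^ p - (b ^ p + 1)"
      using prime_dvd_binomial_power[OF p, of b 1] by simp
    moreover have "(b + 1) ^ p - (b + 1) = ((b + 1) ^ p - (b ^ p + 1)) + (b ^ p - b)"
      by simp
    ultimately show ?thesis by (simp only: dvd_add_right_iff)
  qed
  show ?thesis
  proof (induction a rule: int_induct[of _ 0])
    case base
    show ?case using prime_gt_0_nat[OF p] by (simp add: zero_power)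
  next
    case (step1 i)
    then show ?case by (simp only: step)
  next
    case (step2 i)
    then show ?case using step[of "i - 1"] by simp
  qed
qed

lemma of_int_mult_in_ideal2:
  assumes "int p dvd a"
  shows "of_int a * y \<in> ideal2 f (of_nat p :: 'a::comm_ring_1)"
proof -
  obtain b where "a = int p * b" using assms by (auto elim: dvdE)
  then show ?thesis by (intro ideal2_right) (simp add: mult.assoc)
qed

text \<open>Modulo \<open>p\<close> the \<open>p\<close>-th power is a ring homomorphism that fixes
  the integers \<open>s\<close> and \<open>t\<close>.\<close>

lemma ideal2_frobenius_linear:
  fixes y z :: "'a::comm_ring_1"
  assumes p: "prime p" and y: "y - (of_int s + of_int t * z) \<in> ideal2 f (of_nat p)"
  shows "y ^ p - (of_int s + of_int t * z ^ p) \<in> ideal2 f (of_nat p)"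
proof -
  let ?I = "ideal2 f (of_nat p :: 'a)"
  let ?w = "of_int s + of_int t * z"
  have "y ^ p - ?w ^ p \<in> ?I"
    by (rule ideal2_dvd[OF y power_diff_dvd])
  moreover have "?w ^ p - (of_int s ^ p + (of_int t * z) ^ p) \<in> ?I"
    by (rule ideal2_right[OF prime_dvd_binomial_power[OF p]])
  moreover have "of_int (s ^ p - s) * 1 \<in> ?I" "of_int (t ^ p - t) * z ^ p \<in> ?I"
    by (intro of_int_mult_in_ideal2 prime_dvd_power_diff_self p)+
  ultimately have "(y ^ p - ?w ^ p) + (?w ^ p - (of_int s ^ p + (of_int t * z) ^ p))
      + (of_int (s ^ p - s) * 1 + of_int (t ^ p - t) * z ^ p) \<in> ?I"
    by (intro ideal2_add)
  then show ?thesis by (simp add: algebra_simps power_mult_distrib)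
qed

section \<open>Frobenius modulo the quadratic polynomial\<close>

text \<open>The divisibilities concern the iterates of \<open>z \<mapsto> s + t * z\<close> modulo
  \<open>p\<close>: the first two make the second iterate the identity after multiplication by
  \<open>D\<close>, the last two make the third iterate equal to the first.\<close>

lemma quadratic_power_prime:
  fixes x :: "'a::comm_ring_1" and r1 r2 :: int
  defines "f \<equiv> x\<^sup>2 - of_int r1 * x - of_int r2" and "D \<equiv> r1\<^sup>2 + 4 * r2"
  assumes p: "prime p"
  obtains s t where "x ^ p - (of_int s + of_int t * x) \<in> ideal2 f (of_nat p)"
    and "int p dvd D * (t\<^sup>2 - 1)" "int p dvd D * (s * (1 + t))"
    and "int p dvd t * (t\<^sup>2 - 1)" "int p dvd s * t * (1 + t)"
proof (cases "p = 2")
  case True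
  have "x ^ p - (of_int r2 + of_int r1 * x) \<in> ideal2 f (of_nat p)"
    using True by (intro ideal2_left) (simp add: f_def algebra_simps)
  moreover have "even (D * (r1\<^sup>2 - 1))" "even (D * (r2 * (1 + r1)))"
    "even (r1 * (r1\<^sup>2 - 1))" "even (r2 * r1 * (1 + r1))"
    by (auto simp: D_def)
  ultimately show ?thesis using that[of r2 r1] True by simp
next
  case False
  then have odd: "odd p" using p by (metis primes_dvd_imp_eq two_is_prime_nat)
  let ?I = "ideal2 f (of_nat p :: 'a)"
  define q where "q = (p - 1) div 2"
  have pq: "p = Suc (2 * q)" using odd by (auto simp: q_def elim!: oddE)
  have q0: "q > 0" using p pq by (cases q) auto
  \<comment> \<open>Modulo \<open>p\<close> this is the Legendre symbol of \<open>D\<close>, by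
    Euler's criterion.\<close>
  define t where "t = D ^ q"
  \<comment> \<open>\<open>q + 1\<close> is the inverse of 2 modulo \<open>p\<close>.\<close>
  define h where "h = int q + 1"
  \<comment> \<open>Solving \<open>2 * x ^ p = r1 + t * (2 * x - r1)\<close> for
    \<open>x ^ p\<close> modulo \<open>p\<close> yields this constant term.\<close>
  define s where "s = h * r1 * (1 - t)"
  have ph: "2 * h = int p + 1" by (simp add: pq h_def)
  \<comment> \<open>Completing the square: \<open>\<theta> ^ 2\<close> is \<open>D\<close> modulo
    \<open>f\<close>, so \<open>\<theta> ^ p\<close> becomes \<open>t * \<theta>\<close>.\<close>
  define \<theta> where "\<theta> = 2 * x - of_int r1"
  have "\<theta>\<^sup>2 - of_int D = 4 * f"
    by (simp add: \<theta>_def D_def f_def power2_eq_square algebra_simps)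
  then have "\<theta>\<^sup>2 - of_int D \<in> ?I" by (simp add: ideal2_left)
  from ideal2_dvd[OF this power_diff_dvd, of q]
  have "\<theta> ^ (2 * q) - of_int t \<in> ?I"
    by (simp add: t_def power_mult)
  then have \<theta>: "\<theta> * (\<theta> ^ (2 * q) - of_int t) \<in> ?I" by (rule ideal2_mult_left)
  have "(of_int r1 + \<theta>) ^ p - (of_int r1 ^ p + \<theta> ^ p) \<in> ?I"
    by (rule ideal2_right[OF prime_dvd_binomial_power[OF p]])
  moreover have "of_int r1 + \<theta> = of_int 2 * x" by (simp add: \<theta>_def)
  ultimately have 1: "of_int (2 ^ p) * x ^ p - (of_int (r1 ^ p) + \<theta> ^ p) \<in> ?I"
    by (simp add: power_mult_distrib)
  have 2: "of_int (r1 ^ p - r1) * 1 \<in> ?I" "of_int (2 ^ p - 2) * x ^ p \<in> ?I"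
    by (intro of_int_mult_in_ideal2 prime_dvd_power_diff_self p)+
  \<comment> \<open>The \<open>p\<close>-th power of \<open>2 * x = r1 + \<theta>\<close>, with
    \<open>2 ^ p\<close>, \<open>r1 ^ p\<close> and \<open>\<theta> ^ p\<close> replaced by
    \<open>2\<close>, \<open>r1\<close> and \<open>t * \<theta>\<close>.\<close>
  have "of_int (2 ^ p) * x ^ p - (of_int (r1 ^ p) + \<theta> ^ p) + of_int (r1 ^ p - r1) * 1
      + \<theta> * (\<theta> ^ (2 * q) - of_int t) - of_int (2 ^ p - 2) * x ^ p \<in> ?I"
    by (intro ideal2_add ideal2_diff 1 2 \<theta>)
  also have "of_int (2 ^ p) * x ^ p - (of_int (r1 ^ p) + \<theta> ^ p) + of_int (r1 ^ p - r1) * 1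
      + \<theta> * (\<theta> ^ (2 * q) - of_int t) - of_int (2 ^ p - 2) * x ^ p
      = 2 * x ^ p - (of_int r1 + of_int t * \<theta>)"
    by (simp add: pq algebra_simps)
  finally have "of_int h * (2 * x ^ p - (of_int r1 + of_int t * \<theta>)) \<in> ?I"
    by (rule ideal2_mult_left)
  moreover have "of_int h * (2 * x ^ p - (of_int r1 + of_int t * \<theta>))
      = of_int (2 * h) * (x ^ p - of_int t * x) - of_int s"
    by (simp add: \<theta>_def s_def algebra_simps)
  moreover have "\<dots> = (x ^ p - (of_int s + of_int t * x)) + of_int (int p) * (x ^ p - of_int t * x)"
    unfolding ph by (simp add: algebra_simps)
  moreover have "of_int (int p) * (x ^ p - of_int t * x) \<in> ?I"
    by (rule of_int_mult_in_ideal2) simp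
  ultimately have "x ^ p - (of_int s + of_int t * x) \<in> ?I"
    by (metis ideal2_diff add_diff_cancel_right')
  \<comment> \<open>The right-hand side is \<open>D ^ p - D\<close>.\<close>
  moreover have D1: "int p dvd D * (t\<^sup>2 - 1)"
    using prime_dvd_power_diff_self[OF p, of D]
    by (simp add: pq t_def algebra_simps power_mult[symmetric] mult.commute)
  moreover have "D dvd t" using q0 by (simp add: t_def)
  with D1 have t1: "int p dvd t * (t\<^sup>2 - 1)"
    by (meson dvd_refl dvd_trans mult_dvd_mono)
  \<comment> \<open>Both rest on \<open>s * (1 + t) = - (h * r1) * (t ^ 2 - 1)\<close>.\<close>
  moreover have "int p dvd D * (s * (1 + t))" "int p dvd s * t * (1 + t)"
    using dvd_mult[OF D1, of "- (h * r1)"] dvd_mult[OF t1, of "- (h * r1)"]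
    by (simp_all add: s_def algebra_simps power2_eq_square)
  ultimately show ?thesis using that by blast
qed

text \<open>Frobenius carries the linear expression for \<open>x ^ p\<close> to the next two powers;
  back-substitution leaves exactly the coefficients that the four divisibilities control.\<close>

lemma quadratic_power_prime_orbit:
  fixes x :: "'a::comm_ring_1" and r1 r2 :: int
  defines "f \<equiv> x\<^sup>2 - of_int r1 * x - of_int r2" and "D \<equiv> r1\<^sup>2 + 4 * r2"
  assumes p: "prime p"
  shows "of_int D * (x ^ p\<^sup>2 - x) \<in> ideal2 f (of_nat p)"
    and "x ^ p ^ 3 - x ^ p \<in> ideal2 f (of_nat p)"
proof -
  let ?I = "ideal2 f (of_nat p :: 'a)"
  obtain s t where xp: "x ^ p - (of_int s + of_int t * x) \<in> ?I"
    and st: "int p dvd D * (t\<^sup>2 - 1)" "int p dvd D * (s * (1 + t))"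
      "int p dvd t * (t\<^sup>2 - 1)" "int p dvd s * t * (1 + t)"
    using quadratic_power_prime[OF p] unfolding f_def D_def by blast
  from ideal2_frobenius_linear[OF p xp]
  have xp2: "x ^ p\<^sup>2 - (of_int s + of_int t * x ^ p) \<in> ?I"
    by (simp add: power_mult[symmetric] power2_eq_square)
  from ideal2_frobenius_linear[OF p xp2]
  have xp3: "x ^ p ^ 3 - (of_int s + of_int t * x ^ p\<^sup>2) \<in> ?I"
    by (simp add: power_mult[symmetric] power2_eq_square power3_eq_cube)
  have "of_int D * (x ^ p\<^sup>2 - (of_int s + of_int t * x ^ p))
      + of_int (D * t) * (x ^ p - (of_int s + of_int t * x))
      + of_int (D * (s * (1 + t))) * 1 + of_int (D * (t\<^sup>2 - 1)) * x \<in> ?I"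
    by (intro ideal2_add ideal2_mult_left[OF xp] ideal2_mult_left[OF xp2]
        of_int_mult_in_ideal2 st)
  then show "of_int D * (x ^ p\<^sup>2 - x) \<in> ?I"
    by (simp add: algebra_simps power2_eq_square[of t] power2_eq_square[of "of_int t"])
  have "(x ^ p ^ 3 - (of_int s + of_int t * x ^ p\<^sup>2))
      + of_int t * (x ^ p\<^sup>2 - (of_int s + of_int t * x ^ p))
      + of_int (t\<^sup>2 - 1) * (x ^ p - (of_int s + of_int t * x))
      + of_int (s * t * (1 + t)) * 1 + of_int (t * (t\<^sup>2 - 1)) * x \<in> ?I"
    by (intro ideal2_add ideal2_mult_left[OF xp] ideal2_mult_left[OF xp2] xp3
        of_int_mult_in_ideal2 st)
  then show "x ^ p ^ 3 - x ^ p \<in> ?I"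
    by (simp add: algebra_simps power2_eq_square[of t] power2_eq_square[of "of_int t"])
qed

lemma quadratic_power_prime_power:
  fixes x :: "'a::comm_ring_1" and r1 r2 :: int
  defines "f \<equiv> x\<^sup>2 - of_int r1 * x - of_int r2" and "D \<equiv> r1\<^sup>2 + 4 * r2"
  assumes p: "prime p" and k: "k > 0"
  shows "of_int D * (x ^ (p ^ k * m)\<^sup>2 - x ^ (p ^ (k - 1) * m)\<^sup>2) \<in> ideal2 f (of_nat p ^ k)"
proof (cases "k = 1")
  case True
  have "of_int D * (x ^ p\<^sup>2 - x) dvd of_int D * ((x ^ p\<^sup>2) ^ m\<^sup>2 - x ^ m\<^sup>2)"
    by (intro mult_dvd_mono dvd_refl power_diff_dvd)
  with quadratic_power_prime_orbit(1)[OF p, of r1 r2 x]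
  have "of_int D * ((x ^ p\<^sup>2) ^ m\<^sup>2 - x ^ m\<^sup>2) \<in> ideal2 f (of_nat p)"
    unfolding f_def D_def by (rule ideal2_dvd)
  then show ?thesis using True by (simp add: power_mult_distrib power_mult)
next
  case False
  \<comment> \<open>As \<open>k\<close> is at least 2, nothing is truncated. The exponents
    \<open>2 * k\<close> and \<open>2 * (k - 1)\<close> of \<open>p\<close> become
    \<open>3 + j\<close> and \<open>1 + j\<close>, so the \<open>p ^ j\<close>-th powers of
    \<open>x ^ p ^ 3\<close> and \<open>x ^ p\<close> are compared, and lifting reaches
    \<open>p ^ Suc j\<close>, a multiple of \<open>p ^ k\<close>.\<close>
  define j where "j = 2 * k - 3"
  have j: "2 * k = 3 + j" "2 * (k - 1) = 1 + j" "k \<le> Suc j" using False k by (auto simp: j_def)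
  have e: "(p ^ k * m)\<^sup>2 = p ^ 3 * p ^ j * m\<^sup>2" "(p ^ (k - 1) * m)\<^sup>2 = p * p ^ j * m\<^sup>2"
    using j by (simp_all add: power_mult_distrib flip: power_mult power_add power_Suc)
      (simp_all add: mult.commute)
  have "(x ^ p ^ 3) ^ p ^ j - (x ^ p) ^ p ^ j \<in> ideal2 f (of_nat p ^ Suc j)"
    using quadratic_power_prime_orbit(2)[OF p, of x r1 r2] unfolding f_def
    by (rule ideal2_power_prime_power_lift)
  also have "\<dots> \<subseteq> ideal2 f (of_nat p ^ k)"
    using j by (intro ideal2_mono le_imp_power_dvd)
  finally have "((x ^ p ^ 3) ^ p ^ j) ^ m\<^sup>2 - ((x ^ p) ^ p ^ j) ^ m\<^sup>2 \<in> ideal2 f (of_nat p ^ k)"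
    by (rule ideal2_dvd[OF _ power_diff_dvd])
  then show ?thesis
    unfolding e by (intro ideal2_mult_left) (simp only: power_mult)
qed

section \<open>Sequences as linear functionals on polynomials\<close>

text \<open>The linear functional that sends the \<open>n\<close>-th power of the indeterminate to
  \<open>u n\<close>.\<close>

definition poly_seq :: "(nat \<Rightarrow> 'a) \<Rightarrow> 'a::comm_ring_1 poly \<Rightarrow> 'a" where
  "poly_seq u P = (\<Sum>i\<le>degree P. coeff P i * u i)"

lemma poly_seq_altdef:
  assumes "degree P \<le> n"
  shows "poly_seq u P = (\<Sum>i\<le>n. coeff P i * u i)"
  unfolding poly_seq_def using assms
  by (intro sum.mono_neutral_left) (auto simp: coeff_eq_0)

lemma poly_seq_add: "poly_seq u (P + Q) = poly_seq u P + poly_seq u Q"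
proof -
  let ?n = "max (degree P) (degree Q)"
  have "degree (P + Q) \<le> ?n" by (rule degree_add_le_max)
  then show ?thesis
    by (simp add: poly_seq_altdef[of _ ?n] sum.distrib algebra_simps)
qed

lemma poly_seq_smult: "poly_seq u (smult c P) = c * poly_seq u P"
  by (simp add: poly_seq_altdef[of _ "degree P"] degree_smult_le sum_distrib_left mult.assoc)

lemma poly_seq_diff: "poly_seq u (P - Q) = poly_seq u P - poly_seq u Q"
  using poly_seq_add[of u "P - Q" Q] by simp

lemma poly_seq_pCons: "poly_seq u (pCons a P) = a * u 0 + poly_seq (\<lambda>n. u (Suc n)) P"
proof -
  have "poly_seq u (pCons a P) = (\<Sum>i\<le>Suc (degree P). coeff (pCons a P) i * u i)"
    by (rule poly_seq_altdef) (rule degree_pCons_le)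
  also have "\<dots> = a * u 0 + (\<Sum>i\<le>degree P. coeff P i * u (Suc i))"
    by (subst sum.atMost_Suc_shift) simp
  finally show ?thesis by (simp add: poly_seq_def)
qed

lemma poly_seq_0 [simp]: "poly_seq u 0 = 0"
  by (simp add: poly_seq_def)

lemma poly_seq_X_power: "poly_seq u ([:0, 1:] ^ n) = u n"
  by (induction n arbitrary: u) (simp_all add: poly_seq_pCons one_pCons)

text \<open>Multiplying a polynomial by the indeterminate amounts to shifting \<open>u\<close>, and
  the shifted sequence satisfies the same recurrence; hence the induction generalises over
  \<open>u\<close>. The constant coefficient \<open>c\<close> uses the recurrence at 0.\<close>

lemma poly_seq_recurrence_mult:
  fixes a b :: "'a::comm_ring_1"
  assumes "\<And>n. u (n + 2) = a * u (n + 1) + b * u n"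
  shows "poly_seq u ([:- b, - a, 1:] * P) = 0"
  using assms
proof (induction P arbitrary: u)
  case (pCons c P)
  have "poly_seq (\<lambda>n. u (Suc n)) ([:- b, - a, 1:] * P) = 0"
    using pCons.prems by (intro pCons.IH) (metis add_Suc)
  then have "poly_seq u (pCons 0 ([:- b, - a, 1:] * P)) = 0"
    by (simp add: poly_seq_pCons del: mult_pCons_left)
  moreover have "poly_seq u (smult c [:- b, - a, 1:]) = 0"
    using pCons.prems[of 0] by (simp add: poly_seq_pCons algebra_simps numeral_2_eq_2)
  moreover have "[:- b, - a, 1:] * pCons c P
      = smult c [:- b, - a, 1:] + pCons 0 ([:- b, - a, 1:] * P)"
    by (rule mult_pCons_right)
  ultimately show ?case by (simp only: poly_seq_add add_0_left)
qed simp

section \<open>The discriminant and the almost Dold property\<close>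

text \<open>By completing the square, a zero discriminant leaves \<open>r1 / 2\<close> as the only
  possible root.\<close>

lemma quadratic_discriminant_nonzero:
  fixes r1 r2 :: int
  assumes "card {x :: complex. poly [:- of_int r2, - of_int r1, 1:] x = 0} = 2"
  shows "r1\<^sup>2 + 4 * r2 \<noteq> 0"
proof
  assume D: "r1\<^sup>2 + 4 * r2 = 0"
  have "x = of_int r1 / 2" if "poly [:- of_int r2, - of_int r1, 1:] x = 0" for x :: complex
  proof -
    have "(2 * x - of_int r1)\<^sup>2 = 4 * poly [:- of_int r2, - of_int r1, 1:] x + of_int (r1\<^sup>2 + 4 * r2)"
      by (simp add: power2_eq_square algebra_simps)
    then have "2 * x - of_int r1 = 0" using that D by simp
    then show ?thesis by (simp add: field_simps)
  qed
  then have "{x :: complex. poly [:- of_int r2, - of_int r1, 1:] x = 0} \<subseteq> {of_int r1 / 2}"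
    by blast
  then have "card {x :: complex. poly [:- of_int r2, - of_int r1, 1:] x = 0} \<le> card {of_int r1 / 2 :: complex}"
    by (intro card_mono) auto
  then show False using assms by simp
qed

theorem theorem4:
  fixes r1 r2 :: int and U :: "nat \<Rightarrow> int"
  assumes rec: "\<And>n. n \<ge> 2 \<Longrightarrow> U n = r1 * U (n - 1) + r2 * U (n - 2)"
    and distinct_roots:
      "card {x :: complex. poly [:- of_int r2, - of_int r1, 1:] x = 0} = 2"
  shows "almost_dold (\<lambda>n. U (n\<^sup>2))"
proof -
  define D where "D = r1\<^sup>2 + 4 * r2"
  have D0: "D \<noteq> 0"
    using quadratic_discriminant_nonzero[OF distinct_roots] by (simp add: D_def)
  have rec': "U (n + 2) = r1 * U (n + 1) + r2 * U n" for n
    using rec[of "n + 2"] by simp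
  \<comment> \<open>Taking the indeterminate for \<open>x\<close> makes \<open>f\<close> the
    characteristic polynomial of the recurrence.\<close>
  let ?X = "[:0, 1:] :: int poly"
  have f: "?X\<^sup>2 - of_int r1 * ?X - of_int r2 = [:- r2, - r1, 1:]"
    by (simp add: power2_eq_square of_int_poly)
  have "dold (\<lambda>n. int (nat \<bar>D\<bar>) * U (n\<^sup>2))"
  proof (rule doldI)
    fix p k m :: nat assume "prime p" "k > 0"
    from quadratic_power_prime_power[OF this, where x = ?X and ?r1.0 = r1 and ?r2.0 = r2 and m = m]
    obtain A B where "of_int D * (?X ^ (p ^ k * m)\<^sup>2 - ?X ^ (p ^ (k - 1) * m)\<^sup>2)
        = [:- r2, - r1, 1:] * A + of_nat p ^ k * B"
      unfolding f D_def[symmetric] by (auto simp: ideal2_def)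
    moreover have "of_nat p ^ k * B = smult (int p ^ k) B"
      by (simp add: of_nat_poly poly_const_pow)
    moreover have "of_int D * P = smult D P" for P :: "int poly"
      by (simp add: of_int_poly)
    ultimately have "smult D (?X ^ (p ^ k * m)\<^sup>2 - ?X ^ (p ^ (k - 1) * m)\<^sup>2)
        = [:- r2, - r1, 1:] * A + smult (int p ^ k) B"
      by metis
    \<comment> \<open>The functional kills the multiple of the characteristic polynomial and turns
      powers into terms of \<open>U\<close>.\<close>
    from arg_cong[OF this, of "poly_seq U"]
    have "D * (U ((p ^ k * m)\<^sup>2) - U ((p ^ (k - 1) * m)\<^sup>2)) = int p ^ k * poly_seq U B"
      by (simp only: poly_seq_smult poly_seq_diff poly_seq_add poly_seq_X_power
          poly_seq_recurrence_mult[of U, OF rec'] add_0_left)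
    then have "int p ^ k dvd \<bar>D\<bar> * (U ((p ^ k * m)\<^sup>2) - U ((p ^ (k - 1) * m)\<^sup>2))"
      by (cases "D \<ge> 0") simp_all
    then show "int p ^ k dvd int (nat \<bar>D\<bar>) * U ((p ^ k * m)\<^sup>2)
        - int (nat \<bar>D\<bar>) * U ((p ^ (k - 1) * m)\<^sup>2)"
      by (simp add: right_diff_distrib)
  qed
  with D0 show ?thesis
    unfolding almost_dold_def by (intro exI[of _ "nat \<bar>D\<bar>"]) simp
qed

end
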